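(* Let $w\ge 1$ be an integer, let $U=\{0,1,\ldots,2^w-1\}$, let $a$ be a uniformly random odd integer in $\{0,\ldots,2^w-1\}$, and let $t$ be a uniformly random integer in $\{0,\ldots,2^w-1\}$, independent of $a$. Define the random sampling function $\mathit{Sample}:U\to\{0,1\}$ by $\mathit{Sample}(x)=1$ if $(ax \bmod 2^w)\le t$ and $\mathit{Sample}(x)=0$ otherwise. Then $\mathit{Sample}$ is a distinguisher with probability $1/8$: for every commutative monoid $R$ and every function $v:U\to R$ with $v(x)\neq 0$ for at least one $x\in U$, \[\Pr_{a,t}\Big[\sum\{v(x)\mid x\in U,\ \mathit{Sample}(x)=1\}\neq 0\Big]\ \ge\ 1/8.\]
   Context: A commutative monoid is a set with a commutative, associative addition having a neutral element $0$. The sum $\sum\{v(x)\mid x\in U,\ \mathit{Sample}(x)=1\}$ is the sum in $R$ of the values of the sampled keys (the empty sum is $0$). *)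

theory Defs
  imports "HOL-Probability.Probability"
begin

definition Sample :: "nat \<Rightarrow> nat \<Rightarrow> nat \<Rightarrow> nat \<Rightarrow> nat" where
  "Sample w a t x = (if (a * x) mod 2 ^ w \<le> t then 1 else 0)"

definition seed_pmf :: "nat \<Rightarrow> (nat \<times> nat) pmf" where
  "seed_pmf w = pair_pmf (pmf_of_set {a \<in> {0..<2 ^ w}. odd a}) (pmf_of_set {0..<2 ^ w})"

end

theory Submission
  imports Defs "HOL-Number_Theory.Cong"
begin

text \<open>Fix \<open>a\<close> and sort the \<open>n\<close> keys with nonzero value by \<open>h x = a x mod N\<close>, \<open>N = 2\<^sup>w\<close>. The sampled
  sum is constant for \<open>t\<close> in the gap from a key to the next one (or to \<open>N\<close>), and it cannot vanish on
  two consecutive gaps, nor on the first one, so it is nonzero on at least \<open>n/2\<close> of the \<open>n\<close> gaps.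
  With \<open>D = N/(2n)\<close>, each gap \<open>g\<close> has length at least \<open>D - max 0 (D - g)\<close>. For random \<open>a\<close>,
  every ordered pair of keys, and every pair of a key and \<open>N\<close>, contributes at most \<open>D\<^sup>2/(2N)\<close> to the
  expected total deficit, so the expected number of good \<open>t\<close> is at least
  \<open>D n/2 - n\<^sup>2 D\<^sup>2/(2N) = N/8\<close>.\<close>

section \<open>Mean positive part for a random odd multiplier\<close>

text \<open>By convexity, the midpoint value times the cell length is at most the integral over the
  cell, and \<open>max 0 (D - y)\<close> integrates over \<open>y \<ge> 0\<close> to at most
  \<open>D^2 / 2\<close>.\<close>

lemma midpoint_sum_pos_part_le:
  fixes D M :: real
  assumes "M > 0"
  shows "M * (\<Sum>k<K. max 0 (D - M * (real k + 1 / 2))) \<le> D\<^sup>2 / 2"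
proof -
  \<comment> \<open>\<open>\<phi> y\<close> is the integral of \<open>max 0 (D - s)\<close> over
    \<open>s \<ge> y\<close>, so cell integrals are differences of \<open>\<phi>\<close> and
    telescope.\<close>
  define \<phi> where "\<phi> y = (max 0 (D - y))\<^sup>2 / 2" for y
  have cell: "M * max 0 (D - M * (real k + 1 / 2)) \<le> \<phi> (M * real k) - \<phi> (M * real (Suc k))" for k
  proof -
    define p where "p = D - M * real k"
    have *: "D - M * (real k + 1 / 2) = p - M / 2" "D - M * real (Suc k) = p - M"
      by (simp_all add: p_def algebra_simps)
    have "M * max 0 (p - M / 2) \<le> (max 0 p)\<^sup>2 / 2 - (max 0 (p - M))\<^sup>2 / 2"
    proof (cases "p \<ge> M")
      case True
      then show ?thesis using assms by (simp add: max_def power2_eq_square field_simps)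
    next
      case False
      \<comment> \<open>For \<open>M / 2 < p < M\<close> the claim
        \<open>M * (p - M / 2) \<le> p^2 / 2\<close> rearranges to exactly this square; for smaller
        \<open>p\<close> the left side is zero.\<close>
      have "0 \<le> (p - M)\<^sup>2" by simp
      then show ?thesis using False assms
        by (auto simp: max_def power2_eq_square field_simps)
    qed
    then show ?thesis unfolding \<phi>_def * p_def[symmetric] .
  qed
  have "M * (\<Sum>k<K. max 0 (D - M * (real k + 1 / 2)))
      \<le> (\<Sum>k<K. \<phi> (M * real k) - \<phi> (M * real (Suc k)))"
    unfolding sum_distrib_left by (intro sum_mono cell)
  also have "\<dots> = \<phi> 0 - \<phi> (M * real K)"
    by (subst sum_lessThan_telescope') simp
  also have "\<dots> \<le> D\<^sup>2 / 2"
  proof -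
    have "(max 0 D)\<^sup>2 \<le> D\<^sup>2" by (auto simp: max_def)
    then show ?thesis by (simp add: \<phi>_def le_diff_eq diff_le_eq add_increasing2)
  qed
  finally show ?thesis .
qed

lemma sum_lessThan_mod:
  fixes f :: "nat \<Rightarrow> real"
  shows "(\<Sum>k<m * n. f (k mod n)) = real m * (\<Sum>k<n. f k)"
proof -
  have "(\<Sum>k<m * n. f (k mod n)) = (\<Sum>j<m. \<Sum>k\<in>{j * n..<j * n + n}. f (k mod n))"
    by (rule sum.nat_group[symmetric])
  also have "\<dots> = (\<Sum>j<m. \<Sum>k<n. f k)"
  proof (rule sum.cong[OF refl])
    fix j :: nat
    have "(\<Sum>k\<in>{j * n..<j * n + n}. f (k mod n)) = (\<Sum>k\<in>{0..<n}. f ((k + j * n) mod n))"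
      using sum.shift_bounds_nat_ivl[of "\<lambda>k. f (k mod n)" 0 "j * n" n] by (simp add: add.commute)
    then show "(\<Sum>k\<in>{j * n..<j * n + n}. f (k mod n)) = (\<Sum>k<n. f k)"
      by (simp add: lessThan_atLeast0)
  qed
  finally show ?thesis by simp
qed

text \<open>An odd \<open>q\<close> is a unit modulo \<open>2^w\<close>, and reduction modulo an
  even number keeps parity. \<open>q\<close> is an integer because it will come from a difference of
  keys, which may be negative.\<close>

lemma bij_betw_odd_mult_mod:
  fixes q :: int
  assumes "odd q" "w \<ge> 1"
  shows "bij_betw (\<lambda>a. nat (int a * q mod 2 ^ w)) {a \<in> {0..<2 ^ w}. odd a} {a \<in> {0..<2 ^ w}. odd a}"
proof -
  let ?O = "{a \<in> {0..<2 ^ w}. odd a} :: nat set" and ?f = "\<lambda>a. nat (int a * q mod 2 ^ w)"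
  have ev: "even ((2::int) ^ w)" using assms by simp
  have maps: "?f ` ?O \<subseteq> ?O"
    using assms ev by (auto simp: nat_less_iff even_nat_iff dvd_mod_iff)
  have inj: "inj_on ?f ?O"
  proof (rule inj_onI)
    fix a b assume a: "a \<in> ?O" and b: "b \<in> ?O" and "?f a = ?f b"
    then have "[int a * q = int b * q] (mod 2 ^ w)"
      by (simp add: cong_def nat_eq_iff)
    then have "[int a = int b] (mod 2 ^ w)"
      using assms by (subst (asm) cong_mult_rcancel) auto
    then have "[a = b] (mod 2 ^ w)"
      by (metis cong_int_iff of_nat_numeral of_nat_power)
    then show "a = b" using a b by (auto simp: cong_def)
  qed
  show ?thesis
    using inj maps by (simp add: bij_betw_def endo_inj_surj)
qed

text \<open>For \<open>\<delta> = 2\<^sup>i q\<close> with odd \<open>q\<close>, the residue of \<open>a\<delta>\<close> is equidistributed on the odd multiples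
  of \<open>2\<^sup>i\<close>. These are the midpoints of the cells of length \<open>2\<^bsup>i+1\<^esup>\<close>, so by convexity the mean of
  the positive part is no larger than that of a uniform point of \<open>[0, 2\<^sup>w]\<close>.\<close>

lemma sum_odd_pos_part_mult_mod_le:
  fixes \<delta> :: int and D :: real
  assumes nd: "\<not> 2 ^ w dvd \<delta>"
  shows "(\<Sum>a | a \<in> {0..<2 ^ w} \<and> odd a. max 0 (D - real_of_int (int a * \<delta> mod 2 ^ w))) \<le> D\<^sup>2 / 4"
proof -
  have "\<delta> \<noteq> 0" using nd by auto
  then obtain i q where \<delta>: "\<delta> = 2 ^ i * q" and q: "odd q"
    by (rule multiplicity_decompose'[of \<delta> 2]) auto
  have iw: "i < w"
  proof (rule ccontr)
    assume "\<not> i < w"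
    then have "(2::int) ^ w dvd 2 ^ i" by (simp add: le_imp_power_dvd)
    then show False using nd \<delta> by auto
  qed
  \<comment> \<open>The number of odd multiples of \<open>2^i\<close> below \<open>2^w\<close>,
    hence of cells of length \<open>2 * 2^i\<close>.\<close>
  define K where "K = (2::nat) ^ (w - i - 1)"
  have w: "w = Suc (i + (w - i - 1))" using iw by simp
  have NK: "(2::int) ^ w = 2 ^ i * (2 * int K)"
    by (subst w) (simp add: K_def power_add)
  have NK': "(2::nat) ^ w = 2 * (2 ^ i * K)"
    by (subst w) (simp add: K_def power_add)
  let ?O = "{a. a \<in> {0..<2 ^ w} \<and> odd a} :: nat set"
  let ?g = "\<lambda>r::int. max 0 (D - real_of_int r)"
  have "(\<Sum>a\<in>?O. ?g (int a * \<delta> mod 2 ^ w)) = (\<Sum>a\<in>?O. ?g (int (nat (int a * q mod 2 ^ w)) * 2 ^ i mod 2 ^ w))"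
  proof (rule sum.cong[OF refl])
    fix a
    have "int a * \<delta> = int a * q * 2 ^ i" by (simp add: \<delta>)
    moreover have "int a * q * 2 ^ i mod 2 ^ w = int (nat (int a * q mod 2 ^ w)) * 2 ^ i mod 2 ^ w"
      by (simp add: mod_mult_left_eq)
    ultimately show "?g (int a * \<delta> mod 2 ^ w) = ?g (int (nat (int a * q mod 2 ^ w)) * 2 ^ i mod 2 ^ w)"
      by (simp only:)
  qed
  also have "\<dots> = (\<Sum>a\<in>?O. ?g (int a * 2 ^ i mod 2 ^ w))"
    using bij_betw_odd_mult_mod[OF q, of w] iw
    by (intro sum.reindex_bij_betw[where g = "\<lambda>a. ?g (int a * 2 ^ i mod 2 ^ w)"]) simp
  also have "\<dots> = (\<Sum>k<2 ^ i * K. ?g (int (2 * k + 1) * 2 ^ i mod 2 ^ w))"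
    by (rule sum.reindex_bij_witness[of _ "\<lambda>k. 2 * k + 1" "\<lambda>a. a div 2"])
       (auto simp: NK' elim!: oddE)
  \<comment> \<open>Since \<open>2^w = 2^i * 2K\<close>, the residue depends only on
    \<open>k mod K\<close>; each midpoint is hit \<open>2^i\<close> times.\<close>
  also have "\<dots> = (\<Sum>k<2 ^ i * K. ?g (2 ^ i * int (2 * (k mod K) + 1)))"
  proof (intro sum.cong refl)
    fix k
    have "(1 + 2 * int k) mod (2 * int K) = 1 + 2 * (int k mod int K)"
    proof -
      have "int K > 0" by (simp add: K_def)
      then have "0 \<le> int k mod int K" "int k mod int K < int K" by auto
      moreover have "int k = int K * (int k div int K) + int k mod int K" by simp
      ultimately show ?thesis
        by (intro int_mod_pos_eq[where q = "int k div int K"]) linarith+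
    qed
    then have "int (2 * k + 1) * 2 ^ i mod 2 ^ w = 2 ^ i * int (2 * (k mod K) + 1)"
      unfolding NK by (simp add: mult.commute[of _ "2 ^ i"] zmod_int flip: mult_mod_right)
    then show "?g (int (2 * k + 1) * 2 ^ i mod 2 ^ w) = ?g (2 ^ i * int (2 * (k mod K) + 1))"
      by simp
  qed
  also have "\<dots> = 2 ^ i * (\<Sum>k<K. ?g (2 ^ i * int (2 * k + 1)))"
    using sum_lessThan_mod[of "\<lambda>k. ?g (2 ^ i * int (2 * k + 1))" K "2 ^ i"] by simp
  \<comment> \<open>The multiplicity \<open>2^i\<close> is half the cell length, which halves the
    bound \<open>D^2 / 2\<close>.\<close>
  also have "\<dots> = ((2 * 2 ^ i) * (\<Sum>k<K. max 0 (D - (2 * 2 ^ i) * (real k + 1 / 2)))) / 2"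
    by (simp add: algebra_simps)
  also have "\<dots> \<le> D\<^sup>2 / 2 / 2"
    by (intro divide_right_mono midpoint_sum_pos_part_le) auto
  finally show ?thesis by simp
qed

section \<open>Gaps between sorted hash values\<close>

text \<open>Charging each key for all larger hashes, not only for its successor, overestimates the
  deficit, but each term then concerns a fixed pair of keys and can be averaged over
  \<open>a\<close>, whereas the successor varies with \<open>a\<close>.\<close>

lemma card_nonzero_prefix_sums_ge:
  fixes v :: "'a \<Rightarrow> 'r :: comm_monoid_add" and h :: "'a \<Rightarrow> nat" and D :: real
  assumes fin: "finite A" and inj: "inj_on h A" and less: "\<And>x. x \<in> A \<Longrightarrow> h x < N"
    and nz: "\<And>x. x \<in> A \<Longrightarrow> v x \<noteq> 0" and D: "D \<ge> 0"
  shows "D * real (card A) / 2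
      - (\<Sum>x\<in>A. max 0 (D - (real N - real (h x)))
          + (\<Sum>z | z \<in> A \<and> h x < h z. max 0 (D - (real (h z) - real (h x)))))
    \<le> real (card {t. t < N \<and> (\<Sum>x | x \<in> A \<and> h x \<le> t. v x) \<noteq> 0})"
proof -
  define S where "S t = (\<Sum>x | x \<in> A \<and> h x \<le> t. v x)" for t
  \<comment> \<open>Keys that open a good gap. Inserting \<open>N\<close> into the minimum below
    ends the last gap at \<open>N\<close>.\<close>
  define G where "G = {x \<in> A. S (h x) \<noteq> 0}"
  define nxt where "nxt x = Min (insert N (h ` {z \<in> A. h x < h z}))" for x
  define err where "err x = max 0 (D - (real N - real (h x)))
          + (\<Sum>z | z \<in> A \<and> h x < h z. max 0 (D - (real (h z) - real (h x))))" for x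
  have finG: "finite G" and GA: "G \<subseteq> A" using fin by (auto simp: G_def)
  have nxt_in: "nxt x \<in> insert N (h ` {z \<in> A. h x < h z})" for x
    unfolding nxt_def using fin by (intro Min_in) auto
  have nxt_le_N: "nxt x \<le> N" for x
    unfolding nxt_def using fin by (intro Min_le) auto
  have nxt_le: "nxt x \<le> h z" if "z \<in> A" "h x < h z" for x z
    unfolding nxt_def using fin that by (intro Min_le) auto
  have nxt_gt: "h x < nxt x" if "x \<in> A" for x
    using nxt_in[of x] less[OF that] by auto
  have err_nonneg: "err x \<ge> 0" for x
    unfolding err_def by (intro add_nonneg_nonneg sum_nonneg) auto
  \<comment> \<open>The deficit of the actual gap is one of the nonnegative terms of
    \<open>err x\<close>.\<close>
  have gap: "D - err x \<le> real (nxt x - h x)" if "x \<in> A" for x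
  proof -
    have "max 0 (D - (real (nxt x) - real (h x))) \<le> err x"
    proof (cases "nxt x = N")
      case True
      then show ?thesis unfolding err_def by (simp add: sum_nonneg)
    next
      case False
      then obtain z where z: "z \<in> A" "h x < h z" "nxt x = h z" using nxt_in[of x] by auto
      have "max 0 (D - (real (h z) - real (h x)))
          \<le> (\<Sum>z | z \<in> A \<and> h x < h z. max 0 (D - (real (h z) - real (h x))))"
        using z fin by (intro member_le_sum) auto
      then show ?thesis unfolding err_def z(3) by linarith
    qed
    then show ?thesis using nxt_gt[OF that] by simp
  qed
  have S_const: "S t = S (h x)" if "x \<in> A" "h x \<le> t" "t < nxt x" for x t
  proof -
    have "{z \<in> A. h z \<le> t} = {z \<in> A. h z \<le> h x}"
      using that nxt_le[of _ x] by (auto simp: not_le[symmetric]) (meson leD le_less_trans not_le)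
    then show ?thesis by (simp add: S_def)
  qed
  have "(\<Union>x\<in>G. {h x..<nxt x}) \<subseteq> {t. t < N \<and> S t \<noteq> 0}"
  proof (intro UN_least subsetI)
    fix x t assume "x \<in> G" "t \<in> {h x..<nxt x}"
    then show "t \<in> {t. t < N \<and> S t \<noteq> 0}"
      using S_const[of x t] nxt_le_N[of x] by (auto simp: G_def)
  qed
  then have "card (\<Union>x\<in>G. {h x..<nxt x}) \<le> card {t. t < N \<and> S t \<noteq> 0}"
    by (intro card_mono) auto
  moreover have "card (\<Union>x\<in>G. {h x..<nxt x}) = (\<Sum>x\<in>G. nxt x - h x)"
  proof -
    have "{h x..<nxt x} \<inter> {h y..<nxt y} = {}" if "x \<in> G" "y \<in> G" "x \<noteq> y" for x y
    proof -
      have "h x \<noteq> h y" using that inj GA by (auto dest: inj_onD)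
      then consider "h x < h y" | "h y < h x" by linarith
      then show ?thesis using nxt_le[of x y] nxt_le[of y x] that GA by cases fastforce+
    qed
    then show ?thesis using finG by (subst card_UN_disjoint) auto
  qed
  ultimately have "real (\<Sum>x\<in>G. nxt x - h x) \<le> real (card {t. t < N \<and> S t \<noteq> 0})"
    by (simp only: of_nat_le_iff)
  moreover have "(\<Sum>x\<in>G. D - err x) \<le> real (\<Sum>x\<in>G. nxt x - h x)"
    unfolding of_nat_sum using gap GA by (intro sum_mono) auto
  moreover have "(\<Sum>x\<in>G. err x) \<le> (\<Sum>x\<in>A. err x)"
    using fin GA err_nonneg by (intro sum_mono2) auto
  moreover have "D * real (card A) / 2 \<le> D * real (card G)"
  proof -
    \<comment> \<open>A key with zero prefix sum follows a key with nonzero prefix sum, since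
      \<open>S (h x) = v x\<close> if the preceding prefix sum vanishes.\<close>
    have "\<exists>p. p \<in> G \<and> nxt p = h x" if x: "x \<in> A - G" for x
    proof -
      define P where "P = {z \<in> A. h z < h x}"
      have finP: "finite P" using fin by (simp add: P_def)
      have xA: "x \<in> A" and Sx: "S (h x) = 0" using x by (auto simp: G_def)
      have "{z \<in> A. h z \<le> h x} = insert x P"
        using xA inj by (auto simp: P_def le_less dest: inj_onD)
      then have "S (h x) = v x + (\<Sum>z\<in>P. v z)"
        using finP by (simp add: S_def P_def)
      then have sumP: "(\<Sum>z\<in>P. v z) \<noteq> 0" using Sx nz[OF xA] by auto
      then have "P \<noteq> {}" by auto
      then have "Max (h ` P) \<in> h ` P" using finP by (intro Max_in) auto
      then obtain p where "p \<in> P" "h p = Max (h ` P)" by auto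
      then have p: "p \<in> P" "\<And>z. z \<in> P \<Longrightarrow> h z \<le> h p" using finP by auto
      have "{z \<in> A. h z \<le> h p} = P" using p by (auto simp: P_def)
      then have "S (h p) \<noteq> 0" using sumP by (simp add: S_def)
      moreover have "nxt p = h x"
      proof (rule antisym)
        show "nxt p \<le> h x" using nxt_le[of x p] xA p by (auto simp: P_def)
        show "h x \<le> nxt p"
          using nxt_in[of p] less[OF xA] p(2) by (force simp: P_def)
      qed
      ultimately show ?thesis using p by (auto simp: G_def P_def)
    qed
    \<comment> \<open>Each bad key is the successor of a good one; as \<open>h\<close> is injective
      on \<open>A\<close>, the bad keys do not outnumber the good ones.\<close>
    then have "h ` (A - G) \<subseteq> nxt ` G" by force
    then have "card (h ` (A - G)) \<le> card G"
      using finG by (meson card_image_le card_mono finite_imageI order_trans)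
    then have "card (A - G) \<le> card G"
      using inj by (simp add: card_image inj_on_diff)
    then have "real (card A) / 2 \<le> real (card G)"
      using fin GA finG by (simp add: card_Diff_subset)
    from mult_left_mono[OF this D] show ?thesis by simp
  qed
  ultimately have "D * real (card A) / 2 - (\<Sum>x\<in>A. err x) \<le> real (card {t. t < N \<and> S t \<noteq> 0})"
    by (simp add: sum_subtractf mult.commute)
  then show ?thesis by (simp add: err_def S_def)
qed

section \<open>Averaging over the multiplier and counting seeds\<close>

theorem theorem10:
  fixes w :: nat
    and U :: "nat set"
    and v :: "nat \<Rightarrow> 'r :: comm_monoid_add"
  assumes "w \<ge> 1"
    and "U = {0..<2 ^ w}"
    and "\<exists>x\<in>U. v x \<noteq> 0"
  shows "measure_pmf.prob (seed_pmf w)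
           {(a, t). (\<Sum>x\<in>{x \<in> U. Sample w a t x = 1}. v x) \<noteq> 0} \<ge> 1 / 8"
proof -
  define N where "N = (2::nat) ^ w"
  define A where "A = {x \<in> U. v x \<noteq> 0}"
  define n where "n = card A"
  define Od :: "nat set" where "Od = {a \<in> {0..<2 ^ w}. odd a}"
  define h where "h a x = a * x mod N" for a x :: nat
  \<comment> \<open>This value maximizes the quadratic
    \<open>D * n / 2 - n^2 * D^2 / (2 * N)\<close>.\<close>
  define D where "D = real N / (2 * real n)"
  define T where "T a = {t. t < N \<and> (\<Sum>x | x \<in> A \<and> h a x \<le> t. v x) \<noteq> 0}" for a
  have AN: "x < N" if "x \<in> A" for x
    using that assms by (auto simp: A_def N_def)
  have finA: "finite A" using assms by (simp add: A_def)
  have "A \<noteq> {}" using assms by (auto simp: A_def)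
  then have n: "n \<ge> 1" using finA by (simp add: n_def Suc_le_eq card_gt_0_iff)
  have N: "N > 0" by (simp add: N_def)
  have D: "0 \<le> D" "D \<le> real N"
    using n N by (auto simp: D_def field_simps)
  have finO: "finite Od" by (simp add: Od_def)
  have cardO: "2 * card Od = N"
  proof -
    have "card Od = card {..<(2::nat) ^ (w - 1)}"
      by (rule bij_betw_same_card[of "\<lambda>a. a div 2"],
          rule bij_betw_byWitness[where f' = "\<lambda>k. 2 * k + 1"])
         (use assms(1) in \<open>auto simp: Od_def elim!: oddE simp: power_eq_if[of _ w]\<close>)
    then show ?thesis using assms(1) by (simp add: N_def power_eq_if[of _ w])
  qed
  have inj: "inj_on (h a) A" if "a \<in> Od" for a
  proof (rule inj_onI)
    fix x y assume "x \<in> A" "y \<in> A" "h a x = h a y"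
    then have "[a * x = a * y] (mod 2 ^ w)" by (simp add: cong_def h_def N_def)
    then have "[x = y] (mod 2 ^ w)"
      using that by (subst (asm) cong_mult_lcancel_nat) (auto simp: Od_def)
    then show "x = y" using AN \<open>x \<in> A\<close> \<open>y \<in> A\<close> by (auto simp: cong_def N_def)
  qed
  have ndvd: "\<not> (2::int) ^ w dvd \<delta>" if "\<delta> \<noteq> 0" "\<bar>\<delta>\<bar> < int N" for \<delta>
    using that by (auto simp: N_def dest: dvd_imp_le_int)
  have pair: "(\<Sum>a\<in>Od. if h a x < h a z then max 0 (D - (real (h a z) - real (h a x))) else 0) \<le> D\<^sup>2 / 4"
    if "x \<in> A" "z \<in> A" for x z
  proof (cases "x = z")
    case False
    \<comment> \<open>When \<open>h a x < h a z\<close>, the distance is the residue of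
      \<open>a * (z - x)\<close>; otherwise a zero is replaced by a nonnegative term.\<close>
    have "(\<Sum>a\<in>Od. if h a x < h a z then max 0 (D - (real (h a z) - real (h a x))) else 0)
        \<le> (\<Sum>a\<in>Od. max 0 (D - real_of_int (int a * (int z - int x) mod 2 ^ w)))"
    proof (intro sum_mono)
      fix a
      have "int a * (int z - int x) mod 2 ^ w = int (h a z) - int (h a x)" if "h a x < h a z"
      proof -
        have "int a * (int z - int x) mod 2 ^ w = (int (h a z) - int (h a x)) mod int N"
          by (simp add: h_def N_def zmod_int mod_diff_eq right_diff_distrib)
        moreover have "h a z < N" using N by (simp add: h_def)
        ultimately show ?thesis using that by simp
      qed
      then show "(if h a x < h a z then max 0 (D - (real (h a z) - real (h a x))) else 0)
          \<le> max 0 (D - real_of_int (int a * (int z - int x) mod 2 ^ w))"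
        by simp
    qed
    also have "\<dots> \<le> D\<^sup>2 / 4"
      unfolding Od_def using False AN[OF that(1)] AN[OF that(2)]
      by (intro sum_odd_pos_part_mult_mod_le ndvd) auto
    finally show ?thesis .
  qed simp
  have last: "(\<Sum>a\<in>Od. max 0 (D - (real N - real (h a x)))) \<le> D\<^sup>2 / 4" if "x \<in> A" for x
  \<comment> \<open>Key \<open>0\<close> always hashes to \<open>0\<close>, at distance
    \<open>N \<ge> D\<close> from the end, so its deficit is zero. For other keys the distance to
    \<open>N\<close> is the residue of \<open>- a * x\<close>, because \<open>a * x\<close> is not
    divisible by \<open>2^w\<close>.\<close>
  proof (cases "x = 0")
    case True
    then show ?thesis using D by (simp add: h_def)
  next
    case False
    have nd: "\<not> (2::int) ^ w dvd - int x" using False AN[OF that] by (intro ndvd) auto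
    have "(\<Sum>a\<in>Od. max 0 (D - (real N - real (h a x))))
        = (\<Sum>a\<in>Od. max 0 (D - real_of_int (int a * (- int x) mod 2 ^ w)))"
    proof (intro sum.cong refl)
      fix a assume "a \<in> Od"
      then have "coprime ((2::int) ^ w) (int a)" by (auto simp: Od_def)
      then have "\<not> (2::int) ^ w dvd int a * int x"
        using nd by (simp add: coprime_dvd_mult_right_iff)
      then have "int a * (- int x) mod 2 ^ w = int N - int (h a x)"
        by (simp add: zmod_zminus1_eq_if dvd_eq_mod_eq_0 h_def N_def zmod_int)
      then show "max 0 (D - (real N - real (h a x))) = max 0 (D - real_of_int (int a * (- int x) mod 2 ^ w))"
        by simp
    qed
    also have "\<dots> \<le> D\<^sup>2 / 4"
      unfolding Od_def using nd by (intro sum_odd_pos_part_mult_mod_le) auto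
    finally show ?thesis .
  qed
  \<comment> \<open>With \<open>N / 2\<close> odd multipliers and \<open>D * n = N / 2\<close>, the
    right side is \<open>N^2 / 8 - N^2 / 16\<close>.\<close>
  have "(real N)\<^sup>2 / 16 \<le> (\<Sum>a\<in>Od. D * real n / 2) - real n * (real n * (D\<^sup>2 / 4))"
  proof -
    have Dn: "D * real n = real N / 2" using n by (simp add: D_def)
    have "(\<Sum>a\<in>Od. D * real n / 2) = real (2 * card Od) * (D * real n) / 4" by simp
    also have "\<dots> = (real N)\<^sup>2 / 8" unfolding cardO Dn by (simp add: power2_eq_square)
    finally have 1: "(\<Sum>a\<in>Od. D * real n / 2) = (real N)\<^sup>2 / 8" .
    have "real n * (real n * (D\<^sup>2 / 4)) = (D * real n)\<^sup>2 / 4" by (simp add: power2_eq_square)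
    also have "\<dots> = (real N)\<^sup>2 / 16" unfolding Dn by (simp add: power2_eq_square)
    finally show ?thesis using 1 by simp
  qed
  also have "\<dots> \<le> (\<Sum>a\<in>Od. D * real n / 2)
      - (\<Sum>x\<in>A. (\<Sum>a\<in>Od. max 0 (D - (real N - real (h a x)))) +
         (\<Sum>z\<in>A - {x}. \<Sum>a\<in>Od. if h a x < h a z then max 0 (D - (real (h a z) - real (h a x))) else 0))"
  proof -
    \<comment> \<open>Each key meets \<open>n - 1\<close> other keys and the endpoint
      \<open>N\<close>: \<open>n\<close> contributions of at most \<open>D^2 / 4\<close>.\<close>
    have "(\<Sum>a\<in>Od. max 0 (D - (real N - real (h a x)))) +
         (\<Sum>z\<in>A - {x}. \<Sum>a\<in>Od. if h a x < h a z then max 0 (D - (real (h a z) - real (h a x))) else 0)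
        \<le> real n * (D\<^sup>2 / 4)" if "x \<in> A" for x
    proof -
      have "(\<Sum>z\<in>A - {x}. \<Sum>a\<in>Od. if h a x < h a z then max 0 (D - (real (h a z) - real (h a x))) else 0)
          \<le> real (card (A - {x})) * (D\<^sup>2 / 4)"
        using that pair by (intro sum_bounded_above) auto
      moreover have "real (card (A - {x})) = real n - 1"
        using that finA n by (simp add: n_def of_nat_diff)
      ultimately show ?thesis using last[OF that] by (simp add: algebra_simps)
    qed
    from sum_bounded_above[OF this] show ?thesis by (simp add: n_def)
  qed
  also have "\<dots> = (\<Sum>a\<in>Od. D * real n / 2
      - (\<Sum>x\<in>A. max 0 (D - (real N - real (h a x))) +
         (\<Sum>z\<in>A - {x}. if h a x < h a z then max 0 (D - (real (h a z) - real (h a x))) else 0)))"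
    unfolding sum_subtractf sum.distrib
    by (simp add: sum.swap[of _ Od A] sum.swap[of _ Od "A - {_}"])
  also have "\<dots> \<le> (\<Sum>a\<in>Od. real (card (T a)))"
  proof (intro sum_mono)
    fix a assume a: "a \<in> Od"
    have "{z. z \<in> A \<and> h a x < h a z} = {z \<in> A - {x}. h a x < h a z}" for x by auto
    then have "(\<Sum>z\<in>A - {x}. if h a x < h a z then max 0 (D - (real (h a z) - real (h a x))) else 0)
       = (\<Sum>z | z \<in> A \<and> h a x < h a z. max 0 (D - (real (h a z) - real (h a x))))" for x
      using finA by (simp only: sum.inter_filter finite_Diff)
    moreover have "D * real (card A) / 2
        - (\<Sum>x\<in>A. max 0 (D - (real N - real (h a x)))
            + (\<Sum>z | z \<in> A \<and> h a x < h a z. max 0 (D - (real (h a z) - real (h a x)))))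
      \<le> real (card {t. t < N \<and> (\<Sum>x | x \<in> A \<and> h a x \<le> t. v x) \<noteq> 0})"
    proof (rule card_nonzero_prefix_sums_ge[OF finA inj[OF a] _ _ D(1)])
      show "h a x < N" for x using N by (simp add: h_def)
      show "v x \<noteq> 0" if "x \<in> A" for x using that by (simp add: A_def)
    qed
    ultimately show "D * real n / 2
      - (\<Sum>x\<in>A. max 0 (D - (real N - real (h a x))) +
         (\<Sum>z\<in>A - {x}. if h a x < h a z then max 0 (D - (real (h a z) - real (h a x))) else 0))
      \<le> real (card (T a))"
      by (simp only: T_def n_def)
  qed
  also have "\<dots> = real (card (Sigma Od T))"
    using finO by (subst card_SigmaI) (auto simp: T_def)
  finally have main: "(real N)\<^sup>2 / 16 \<le> real (card (Sigma Od T))" .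

  have neO: "Od \<noteq> {}" using cardO N by auto
  have seed: "seed_pmf w = pmf_of_set (Od \<times> {0..<N})"
    using finO neO N unfolding seed_pmf_def Od_def[symmetric] unfolding N_def
    by (intro pmf_eqI) (auto simp: pmf_pair pmf_of_set[OF neO finO] pmf_of_set indicator_def split: prod.splits)
  \<comment> \<open>Keys of value zero do not affect the sampled sum, so it is a prefix sum over
    \<open>A\<close>.\<close>
  have sample: "(\<Sum>x\<in>{x \<in> U. Sample w a t x = 1}. v x) = (\<Sum>x | x \<in> A \<and> h a x \<le> t. v x)" for a t
    using assms(2) by (intro sum.mono_neutral_right) (auto simp: A_def Sample_def h_def N_def split: if_splits)
  have inter: "(Od \<times> {0..<N}) \<inter> {(a, t). (\<Sum>x\<in>{x \<in> U. Sample w a t x = 1}. v x) \<noteq> 0} = Sigma Od T"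
    unfolding sample by (auto simp: T_def)
  \<comment> \<open>At least \<open>N^2 / 16\<close> of the \<open>N^2 / 2\<close> equally likely
    seeds are good, which gives \<open>1 / 8\<close>.\<close>
  have "measure_pmf.prob (seed_pmf w) {(a, t). (\<Sum>x\<in>{x \<in> U. Sample w a t x = 1}. v x) \<noteq> 0}
      = real (card (Sigma Od T)) / real (card (Od \<times> {0..<N}))"
    unfolding seed using finO neO N by (subst measure_pmf_of_set) (simp_all only: inter, auto)
  also have "real (card (Od \<times> {0..<N})) = (real N)\<^sup>2 / 2"
  proof -
    have "real (card (Od \<times> {0..<N})) = real (2 * card Od) * real N / 2"
      by (simp add: card_cartesian_product)
    then show ?thesis unfolding cardO by (simp add: power2_eq_square)
  qed
  also have "1 / 8 \<le> real (card (Sigma Od T)) / ((real N)\<^sup>2 / 2)"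
    using main N by (simp add: field_simps)
  finally show ?thesis .
qed

end
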